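(* Let $q$ be the complex deformation parameter and let $\mathcal{A}_q$ be the unital associative $\mathbb{C}$-algebra generated by $c$ and $c^{\dagger}$ subject to the single relation $cc^{\dagger}-q\,c^{\dagger}c=1$. Let $F(c,c^{\dagger})$ be any finite word in the letters $c$ and $c^{\dagger}$, regarded also as the corresponding product in $\mathcal{A}_q$. Then the normally ordered form $\mathcal{N}_q[F(c,c^{\dagger})]$ is given by $$\mathcal{N}_q[F(c,c^{\dagger})]=F(c,c^{\dagger})=\sum_{\gamma\in\mathscr{F}(F(c,c^{\dagger}))}\mathscr{W}_q(\gamma)\; :\gamma:\,,$$ where the sum runs over all Feynman diagrams $\gamma$ on the word $F(c,c^{\dagger})$, $\mathscr{W}_q(\gamma)=q^{tc(\gamma)+l(\gamma)}$ is the $q$-weight of $\gamma$, and $:\gamma:$ is its double dot monomial.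
   Context: Normal ordering: the normally ordered form $\mathcal{N}_q[F(c,c^{\dagger})]$ of a word $F(c,c^{\dagger})$ is the expression of the element $F(c,c^{\dagger})\in\mathcal{A}_q$ as $\sum_{k,l}C_{k,l}(q)(c^{\dagger})^k c^l$, i.e. with all $c^{\dagger}$ to the left of all $c$, obtained by using the relation $cc^{\dagger}=q\,c^{\dagger}c+1$. As an element of $\mathcal{A}_q$ it equals $F(c,c^{\dagger})$. Feynman diagrams: let $w=s_1s_2\cdots s_N$ be a word with each $s_i\in\{c,c^{\dagger}\}$. The positions $1,\dots,N$ are called vertices; a vertex $i$ is of type $\mathscr{A}$ (annihilator) if $s_i=c$ and of type $\mathscr{C}$ (creator) if $s_i=c^{\dagger}$. A Feynman diagram $\gamma$ on $w$ is a (possibly empty) set of ordered pairs $\gamma=\{(i_1,j_1),\dots,(i_p,j_p)\}$, called edges, such that for every edge $i_k<j_k$, $i_k$ is of type $\mathscr{A}$, $j_k$ is of type $\mathscr{C}$, and no vertex belongs to two different edges. The number $p$ is the degree of $\gamma$. Vertices not belonging to any edge are called singletons of $\gamma$. $\mathscr{F}(w)$ denotes the set of all Feynman diagrams on $w$. Double dot: if $\gamma$ has exactly $r$ singletons of type $\mathscr{C}$ and $s$ singletons of type $\mathscr{A}$, then $:\gamma:\;=(c^{\dagger})^r c^s$. Weight: - Crossing number: $c(\gamma)$ is the number of pairs of edges $(i,j),(i',j')\in\gamma$ with $i<i'<j<j'$. - Degenerate crossings: $d(\gamma)$ is the number of triples $i<k<j$ such that $(i,j)\in\gamma$ and $k$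 is a singleton of $\gamma$ (of either type). - Total crossing number: $tc(\gamma)=c(\gamma)+d(\gamma)$. - Length: $l(\gamma)$ is the number of pairs $(k,k')$ of singletons of $\gamma$ with $k<k'$, $k$ of type $\mathscr{A}$ and $k'$ of type $\mathscr{C}$. - The $q$-weight is $\mathscr{W}_q(\gamma)=q^{tc(\gamma)+l(\gamma)}$ (with $q^0=1$). *)

theory Defs
  imports "HOL-Algebra.Algebra" "HOL-Library.Poly_Mapping" Complex_Main
begin

section \<open>The algebra of the \<open>q\<close>-deformed boson\<close>

datatype letter = Ann | Cre

text \<open>
  Words form the free monoid under concatenation. Declaring this as an additive monoid makes
  the finitely supported functions \<^typ>\<open>letter list \<Rightarrow>\<^sub>0 complex\<close>, whose
  product is convolution, the free unital associative \<open>\<complex>\<close>-algebra on two generators.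
\<close>

instantiation list :: (type) monoid_add
begin

definition zero_list_def: "0 = []"

definition plus_list_def: "xs + ys = xs @ ys"

instance
  by standard (simp_all add: zero_list_def plus_list_def)

end

definition free_algebra :: "(letter list \<Rightarrow>\<^sub>0 complex) ring" where
  "free_algebra =
     \<lparr>carrier = UNIV, monoid.mult = (*), one = 1, ring.zero = 0, add = (+)\<rparr>"

definition free_gen :: "letter \<Rightarrow> letter list \<Rightarrow>\<^sub>0 complex" where
  "free_gen s = Poly_Mapping.single [s] 1"

definition free_const :: "complex \<Rightarrow> letter list \<Rightarrow>\<^sub>0 complex" where
  "free_const a = Poly_Mapping.single [] a"

definition q_ideal :: "complex \<Rightarrow> (letter list \<Rightarrow>\<^sub>0 complex) set" where
  "q_ideal q = genideal free_algebra
     {free_gen Ann * free_gen Cre - free_const q * (free_gen Cre * free_gen Ann) - 1}"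

definition q_class ::
    "complex \<Rightarrow> (letter list \<Rightarrow>\<^sub>0 complex) \<Rightarrow> (letter list \<Rightarrow>\<^sub>0 complex) set" where
  "q_class q p = q_ideal q +>\<^bsub>free_algebra\<^esub> p"

text \<open>
  The quotient ring is turned into a \<open>\<complex>\<close>-algebra by letting a scalar act as
  multiplication by the class of the corresponding constant.
\<close>

definition q_algebra :: "complex \<Rightarrow> (complex, (letter list \<Rightarrow>\<^sub>0 complex) set) module" where
  "q_algebra q = (let Q = free_algebra Quot q_ideal q in
     \<lparr>carrier = carrier Q, monoid.mult = monoid.mult Q, one = one Q, ring.zero = ring.zero Q, add = add Q,
      smult = (\<lambda>a x. q_class q (free_const a) \<otimes>\<^bsub>Q\<^esub> x)\<rparr>)"

definition q_gen :: "complex \<Rightarrow> letter \<Rightarrow> (letter list \<Rightarrow>\<^sub>0 complex) set" where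
  "q_gen q s = q_class q (free_gen s)"

definition word_elem :: "complex \<Rightarrow> letter list \<Rightarrow> (letter list \<Rightarrow>\<^sub>0 complex) set" where
  "word_elem q w = foldr (\<lambda>s x. q_gen q s \<otimes>\<^bsub>q_algebra q\<^esub> x) w \<one>\<^bsub>q_algebra q\<^esub>"

definition normal_monomial :: "complex \<Rightarrow> nat \<Rightarrow> nat \<Rightarrow> (letter list \<Rightarrow>\<^sub>0 complex) set" where
  "normal_monomial q k l =
     q_gen q Cre [^]\<^bsub>q_algebra q\<^esub> k \<otimes>\<^bsub>q_algebra q\<^esub> q_gen q Ann [^]\<^bsub>q_algebra q\<^esub> l"


section \<open>Normal ordering\<close>

definition normal_expr ::
    "complex \<Rightarrow> (nat \<times> nat \<Rightarrow> complex) \<Rightarrow> (letter list \<Rightarrow>\<^sub>0 complex) set" where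
  "normal_expr q C = (\<Oplus>\<^bsub>q_algebra q\<^esub>m \<in> {m. C m \<noteq> 0}.
     C m \<odot>\<^bsub>q_algebra q\<^esub> normal_monomial q (fst m) (snd m))"

text \<open>
  The definite description is legitimate because the monomials with all creators on the left
  form a basis of the algebra, for every complex \<open>q\<close>.
\<close>

definition normal_coeffs :: "complex \<Rightarrow> letter list \<Rightarrow> nat \<times> nat \<Rightarrow> complex" where
  "normal_coeffs q w = (THE C. finite {m. C m \<noteq> 0} \<and> normal_expr q C = word_elem q w)"

definition normal_order :: "complex \<Rightarrow> letter list \<Rightarrow> (letter list \<Rightarrow>\<^sub>0 complex) set" where
  "normal_order q w = normal_expr q (normal_coeffs q w)"


section \<open>Feynman diagrams\<close>

text \<open>
  The vertices of the word \<open>w\<close> are its list positions, numbered from \<open>0\<close> to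
  \<open>length w - 1\<close>.
\<close>

definition feynman :: "letter list \<Rightarrow> (nat \<times> nat) set set" where
  "feynman w = {\<gamma>.
     (\<forall>(i, j) \<in> \<gamma>. i < j \<and> j < length w \<and> w ! i = Ann \<and> w ! j = Cre) \<and>
     (\<forall>e \<in> \<gamma>. \<forall>e' \<in> \<gamma>. e \<noteq> e' \<longrightarrow> {fst e, snd e} \<inter> {fst e', snd e'} = {})}"

definition singletons :: "letter list \<Rightarrow> (nat \<times> nat) set \<Rightarrow> nat set" where
  "singletons w \<gamma> = {k. k < length w \<and> (\<forall>(i, j) \<in> \<gamma>. k \<noteq> i \<and> k \<noteq> j)}"

definition singletons_of :: "letter \<Rightarrow> letter list \<Rightarrow> (nat \<times> nat) set \<Rightarrow> nat set" where
  "singletons_of s w \<gamma> = {k \<in> singletons w \<gamma>. w ! k = s}"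

definition double_dot ::
    "complex \<Rightarrow> letter list \<Rightarrow> (nat \<times> nat) set \<Rightarrow> (letter list \<Rightarrow>\<^sub>0 complex) set" where
  "double_dot q w \<gamma> =
     normal_monomial q (card (singletons_of Cre w \<gamma>)) (card (singletons_of Ann w \<gamma>))"

definition crossings :: "(nat \<times> nat) set \<Rightarrow> nat" where
  "crossings \<gamma> = card {((i, j), (i', j')).
     (i, j) \<in> \<gamma> \<and> (i', j') \<in> \<gamma> \<and> i < i' \<and> i' < j \<and> j < j'}"

definition degenerate_crossings :: "letter list \<Rightarrow> (nat \<times> nat) set \<Rightarrow> nat" where
  "degenerate_crossings w \<gamma> = card {(i, k, j).
     i < k \<and> k < j \<and> (i, j) \<in> \<gamma> \<and> k \<in> singletons w \<gamma>}"

definition total_crossings :: "letter list \<Rightarrow> (nat \<times> nat) set \<Rightarrow> nat" where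
  "total_crossings w \<gamma> = crossings \<gamma> + degenerate_crossings w \<gamma>"

definition diagram_length :: "letter list \<Rightarrow> (nat \<times> nat) set \<Rightarrow> nat" where
  "diagram_length w \<gamma> = card {(k, k').
     k < k' \<and> k \<in> singletons_of Ann w \<gamma> \<and> k' \<in> singletons_of Cre w \<gamma>}"

definition q_weight :: "complex \<Rightarrow> letter list \<Rightarrow> (nat \<times> nat) set \<Rightarrow> complex" where
  "q_weight q w \<gamma> = q ^ (total_crossings w \<gamma> + diagram_length w \<gamma>)"

end

theory Submission
  imports Defs
begin

text \<open>
  The expansion is proved by induction on the word, adding letters on the left. A creator put in
  front changes no weight. An annihilator put in front of \<open>:\<gamma>:\<close> with \<open>r\<close> creators satisfies
  \<open>c (c\<^sup>\<dagger>)\<^sup>r = q\<^sup>r (c\<^sup>\<dagger>)\<^sup>r c + (1 + q + \<dots> + q\<^sup>r\<^sup>-\<^sup>1) (c\<^sup>\<dagger>)\<^sup>r\<^sup>-\<^sup>1\<close>: the first summand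
  leaves the new vertex single, and the term \<open>q\<^sup>i\<close> of the second one contracts it with the single
  creator that has \<open>i\<close> single creators to its left. The coefficients are unique because the
  algebra acts on functions of \<open>(k, l)\<close> such that the monomial \<open>(c\<^sup>\<dagger>)\<^sup>k c\<^sup>l\<close> maps the
  indicator of \<open>(0, 0)\<close> to the indicator of \<open>(k, l)\<close>.
\<close>

section \<open>The quotient algebra and its relation\<close>

lemma ring_free_algebra: "ring free_algebra"
proof (rule ringI)
  show "abelian_group free_algebra"
    by (rule abelian_groupI)
      (auto simp: free_algebra_def add.assoc add.commute intro: exI[of _ "- x" for x] add.right_inverse)
  show "Group.monoid free_algebra"
    by (rule monoidI) (auto simp: free_algebra_def mult.assoc)
qed (auto simp: free_algebra_def algebra_simps)

lemma ideal_q_ideal: "ideal (q_ideal q) free_algebra"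
  unfolding q_ideal_def by (rule ring.genideal_ideal[OF ring_free_algebra]) (simp add: free_algebra_def)

lemma q_relation_in_q_ideal:
  "free_gen Ann * free_gen Cre - free_const q * (free_gen Cre * free_gen Ann) - 1 \<in> q_ideal q"
  unfolding q_ideal_def
  by (rule ring.genideal_self'[OF ring_free_algebra]) (simp add: free_algebra_def)

lemma q_class_ring_hom_ring:
  "ring_hom_ring free_algebra (free_algebra Quot q_ideal q) (q_class q)"
proof -
  have "q_class q = (+>\<^bsub>free_algebra\<^esub>) (q_ideal q)"
    by (simp add: fun_eq_iff q_class_def)
  then show ?thesis
    using ideal.rcos_ring_hom_ring[OF ideal_q_ideal, of q] by simp
qed

text \<open>The algebra record only adds a scalar action to the quotient ring, so every computation
  is moved to the quotient, where \<open>q_class q\<close> is a ring homomorphism.\<close>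

lemma q_algebra_simps [simp]:
  "carrier (q_algebra q) = carrier (free_algebra Quot q_ideal q)"
  "x \<otimes>\<^bsub>q_algebra q\<^esub> y = x \<otimes>\<^bsub>free_algebra Quot q_ideal q\<^esub> y"
  "\<one>\<^bsub>q_algebra q\<^esub> = \<one>\<^bsub>free_algebra Quot q_ideal q\<^esub>"
  "\<zero>\<^bsub>q_algebra q\<^esub> = \<zero>\<^bsub>free_algebra Quot q_ideal q\<^esub>"
  "x \<oplus>\<^bsub>q_algebra q\<^esub> y = x \<oplus>\<^bsub>free_algebra Quot q_ideal q\<^esub> y"
  "a \<odot>\<^bsub>q_algebra q\<^esub> x = q_class q (free_const a) \<otimes>\<^bsub>free_algebra Quot q_ideal q\<^esub> x"
  by (simp_all add: q_algebra_def Let_def)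

lemma q_algebra_pow: "x [^]\<^bsub>q_algebra q\<^esub> (n::nat) = x [^]\<^bsub>free_algebra Quot q_ideal q\<^esub> n"
  by (simp add: nat_pow_def)

lemma q_algebra_finsum: "finsum (q_algebra q) = finsum (free_algebra Quot q_ideal q)"
  by (simp add: fun_eq_iff finsum_def finprod_def q_algebra_def Let_def)

lemma q_class_closed [simp]: "q_class q p \<in> carrier (free_algebra Quot q_ideal q)"
  using ring_hom_closed[OF ring_hom_ring.homh[OF q_class_ring_hom_ring], of p q] by (simp add: free_algebra_def)

lemma q_class_add:
  "q_class q (p + r) = q_class q p \<oplus>\<^bsub>free_algebra Quot q_ideal q\<^esub> q_class q r"
  using ring_hom_add[OF ring_hom_ring.homh[OF q_class_ring_hom_ring], of p r q] by (simp add: free_algebra_def)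

lemma q_class_mult:
  "q_class q (p * r) = q_class q p \<otimes>\<^bsub>free_algebra Quot q_ideal q\<^esub> q_class q r"
  using ring_hom_mult[OF ring_hom_ring.homh[OF q_class_ring_hom_ring], of p r q] by (simp add: free_algebra_def)

lemma q_class_one: "q_class q 1 = \<one>\<^bsub>free_algebra Quot q_ideal q\<^esub>"
  using ring_hom_one[OF ring_hom_ring.homh[OF q_class_ring_hom_ring], of q] by (simp add: free_algebra_def)

lemma q_class_zero: "q_class q 0 = \<zero>\<^bsub>free_algebra Quot q_ideal q\<^esub>"
proof -
  interpret ring_hom_ring free_algebra "free_algebra Quot q_ideal q" "q_class q"
    by (rule q_class_ring_hom_ring)
  show ?thesis
    using hom_zero by (simp add: free_algebra_def)
qed

lemma q_class_pow: "q_class q (p ^ n) = q_class q p [^]\<^bsub>free_algebra Quot q_ideal q\<^esub> n"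
  by (induction n) (simp_all add: q_class_one power_Suc2 q_class_mult nat_pow_def del: power_Suc)

lemma q_class_sum:
  assumes "finite A"
  shows "q_class q (\<Sum>a\<in>A. p a) = (\<Oplus>\<^bsub>free_algebra Quot q_ideal q\<^esub>a\<in>A. q_class q (p a))"
proof -
  interpret Q: ring "free_algebra Quot q_ideal q"
    by (rule ideal.quotient_is_ring[OF ideal_q_ideal])
  show ?thesis
    using assms by (induction A) (simp_all add: q_class_zero q_class_add)
qed

lemma q_class_sum_cong:
  assumes "\<And>a. a \<in> A \<Longrightarrow> q_class q (p a) = q_class q (r a)"
  shows "q_class q (\<Sum>a\<in>A. p a) = q_class q (\<Sum>a\<in>A. r a)"
  using assms by (induction A rule: infinite_finite_induct) (simp_all add: q_class_add)

text \<open>As 0 lies in the ideal, \<open>p\<close> belongs to its own coset and hence to that of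
  \<open>r\<close>. This turns an equality of classes into an equation in the free algebra.\<close>

lemma q_class_eqD:
  assumes "q_class q p = q_class q r"
  obtains i where "i \<in> q_ideal q" "p = i + r"
proof -
  have eq: "q_class q x = {i + x | i. i \<in> q_ideal q}" for x
    by (auto simp: q_class_def a_r_coset_def' free_algebra_def)
  have "0 \<in> q_ideal q"
    using additive_subgroup.zero_closed[OF ideal.axioms(1)[OF ideal_q_ideal]] by (simp add: free_algebra_def)
  then have "p \<in> q_class q p"
    unfolding eq by force
  then show ?thesis
    using that assms unfolding eq by auto
qed

section \<open>Words as representatives, and moving an annihilator to the right\<close>

abbreviation word :: "letter list \<Rightarrow> letter list \<Rightarrow>\<^sub>0 complex" where
  "word w \<equiv> Poly_Mapping.single w 1"

abbreviation normal_word :: "nat \<Rightarrow> nat \<Rightarrow> letter list" where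
  "normal_word k l \<equiv> replicate k Cre @ replicate l Ann"

lemma single_mult_list:
  fixes a b :: complex
  shows "Poly_Mapping.single v a * Poly_Mapping.single w b = Poly_Mapping.single (v @ w) (a * b)"
  by (simp add: mult_single plus_list_def)

lemma word_Nil: "word [] = 1"
  by (metis single_one zero_list_def)

lemma word_elem_eq_q_class: "word_elem q w = q_class q (word w)"
proof (induction w)
  case Nil
  then show ?case by (simp add: word_elem_def word_Nil q_class_one)
next
  case (Cons s w)
  then show ?case
    by (simp add: word_elem_def q_gen_def free_gen_def single_mult_list flip: q_class_mult)
qed

lemma free_gen_pow: "free_gen s ^ n = word (replicate n s)"
  by (induction n) (simp_all add: word_Nil free_gen_def single_mult_list)

text \<open>The scalar becomes the coefficient of one word, so linear combinations of monomials can
  be handled in the free algebra before passing to classes.\<close>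

lemma smult_normal_monomial:
  "a \<odot>\<^bsub>q_algebra q\<^esub> normal_monomial q k l = q_class q (Poly_Mapping.single (normal_word k l) a)"
  by (simp add: normal_monomial_def q_algebra_pow q_gen_def free_gen_pow free_const_def single_mult_list
      flip: q_class_pow q_class_mult)

lemma q_class_relation:
  "q_class q (word [Ann, Cre]) = q_class q (Poly_Mapping.single [Cre, Ann] q + 1)"
proof -
  interpret I: ideal "q_ideal q" free_algebra by (rule ideal_q_ideal)
  let ?d = "word [Ann, Cre] - (Poly_Mapping.single [Cre, Ann] q + 1)"
  have "?d \<in> q_ideal q"
    using q_relation_in_q_ideal[of q]
    by (simp add: free_gen_def free_const_def single_mult_list diff_diff_eq)
  then have "q_class q ?d = q_class q 0"
    using I.a_rcos_const[of ?d] I.a_rcos_const[OF additive_subgroup.zero_closed[OF I.additive_subgroup_axioms]]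
    by (simp add: q_class_def free_algebra_def)
  then have "q_class q (?d + (Poly_Mapping.single [Cre, Ann] q + 1))
      = q_class q (0 + (Poly_Mapping.single [Cre, Ann] q + 1))"
    by (simp only: q_class_add)
  then show ?thesis by simp
qed

text \<open>Each creator passed contributes a factor \<open>q\<close> and one contracted word; the
  latter add up to the q-number [k] = 1 + q + ... + q^(k-1). At \<open>k = 0\<close> the truncated
  \<open>k - 1\<close> is harmless because the coefficient is 0.\<close>

lemma q_class_annihilator_commute:
  "q_class q (word (Ann # replicate k Cre)) =
   q_class q (Poly_Mapping.single (replicate k Cre @ [Ann]) (q ^ k)
     + Poly_Mapping.single (replicate (k - 1) Cre) (\<Sum>i<k. q ^ i))"
proof (induction k)
  case 0
  then show ?case by simp
next
  case (Suc k)
  have "q_class q (word (Ann # replicate (Suc k) Cre)) =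
      q_class q (word [Ann, Cre] * word (replicate k Cre))"
    by (simp add: single_mult_list)
  also have "\<dots> = q_class q ((Poly_Mapping.single [Cre, Ann] q + 1) * word (replicate k Cre))"
    by (simp only: q_class_mult q_class_relation)
  also have "\<dots> = q_class q (Poly_Mapping.single [Cre] q * word (Ann # replicate k Cre)
      + word (replicate k Cre))"
    by (simp add: single_mult_list distrib_right)
  also have "\<dots> = q_class q (Poly_Mapping.single [Cre] q *
      (Poly_Mapping.single (replicate k Cre @ [Ann]) (q ^ k)
        + Poly_Mapping.single (replicate (k - 1) Cre) (\<Sum>i<k. q ^ i)) + word (replicate k Cre))"
    by (simp only: q_class_mult q_class_add Suc.IH)
  also have "Poly_Mapping.single [Cre] q *
      (Poly_Mapping.single (replicate k Cre @ [Ann]) (q ^ k)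
        + Poly_Mapping.single (replicate (k - 1) Cre) (\<Sum>i<k. q ^ i)) + word (replicate k Cre)
      = Poly_Mapping.single (replicate (Suc k) Cre @ [Ann]) (q ^ Suc k)
        + Poly_Mapping.single (replicate (Suc k - 1) Cre) (\<Sum>i<Suc k. q ^ i)"
    \<comment> \<open>The coefficients match by [k+1] = 1 + q [k]. The case split is there because a
      creator in front of \<open>replicate (k - 1) Cre\<close> gives \<open>replicate k Cre\<close>
      only for positive \<open>k\<close>.\<close>
    by (cases k) (simp_all only: sum.lessThan_Suc_shift,
      simp_all add: single_mult_list distrib_left word_Nil flip: single_add sum_distrib_left,
      simp_all add: add_ac flip: single_add)
  finally show ?case .
qed

lemma q_class_annihilator_normal_word:
  "q_class q (Poly_Mapping.single (Ann # normal_word k l) a) =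
   q_class q (Poly_Mapping.single (normal_word k (Suc l)) (a * q ^ k)
     + Poly_Mapping.single (normal_word (k - 1) l) (a * (\<Sum>i<k. q ^ i)))"
proof -
  let ?W = "Poly_Mapping.single (replicate l Ann) a"
  have "q_class q (Poly_Mapping.single (Ann # normal_word k l) a)
      = q_class q (word (Ann # replicate k Cre) * ?W)"
    by (simp add: single_mult_list)
  also have "\<dots> = q_class q ((Poly_Mapping.single (replicate k Cre @ [Ann]) (q ^ k)
     + Poly_Mapping.single (replicate (k - 1) Cre) (\<Sum>i<k. q ^ i)) * ?W)"
    by (simp only: q_class_mult q_class_annihilator_commute)
  also have "(Poly_Mapping.single (replicate k Cre @ [Ann]) (q ^ k)
     + Poly_Mapping.single (replicate (k - 1) Cre) (\<Sum>i<k. q ^ i)) * ?W =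
     Poly_Mapping.single (normal_word k (Suc l)) (a * q ^ k)
     + Poly_Mapping.single (normal_word (k - 1) l) (a * (\<Sum>i<k. q ^ i))"
    by (simp add: single_mult_list distrib_right mult.commute)
  finally show ?thesis .
qed

section \<open>A representation separating the normally ordered monomials\<close>

text \<open>
  This is the left regular representation in the coordinates of the normally ordered
  monomials: the value of a function at \<open>(k, l)\<close> is the coefficient of
  \<open>(c\<^sup>\<dagger>)\<^sup>k c\<^sup>l\<close>, and \<open>c (c\<^sup>\<dagger>)\<^sup>k = q\<^sup>k (c\<^sup>\<dagger>)\<^sup>k c + [k]\<^sub>q (c\<^sup>\<dagger>)\<^sup>k\<^sup>-\<^sup>1\<close>.
\<close>

fun letter_op :: "complex \<Rightarrow> letter \<Rightarrow> (nat \<times> nat \<Rightarrow> complex) \<Rightarrow> nat \<times> nat \<Rightarrow> complex" where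
  "letter_op q Cre f (k, l) = (if k = 0 then 0 else f (k - 1, l))"
| "letter_op q Ann f (k, l) =
    (if l = 0 then 0 else q ^ k * f (k, l - 1)) + (\<Sum>i\<le>k. q ^ i) * f (Suc k, l)"

abbreviation word_op :: "complex \<Rightarrow> letter list \<Rightarrow> (nat \<times> nat \<Rightarrow> complex) \<Rightarrow> nat \<times> nat \<Rightarrow> complex" where
  "word_op q \<equiv> foldr (letter_op q)"

definition free_op :: "complex \<Rightarrow> (letter list \<Rightarrow>\<^sub>0 complex) \<Rightarrow> (nat \<times> nat \<Rightarrow> complex) \<Rightarrow> nat \<times> nat \<Rightarrow> complex" where
  "free_op q p f m = (\<Sum>w\<in>Poly_Mapping.keys p. Poly_Mapping.lookup p w * word_op q w f m)"

lemma letter_op_linear: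
  "letter_op q s (\<lambda>m. \<Sum>x\<in>A. a x * f x m) = (\<lambda>m. \<Sum>x\<in>A. a x * letter_op q s (f x) m)"
proof
  fix m show "letter_op q s (\<lambda>m. \<Sum>x\<in>A. a x * f x m) m = (\<Sum>x\<in>A. a x * letter_op q s (f x) m)"
    by (cases m; cases s) (auto simp: sum_distrib_left sum.distrib algebra_simps)
qed

lemma word_op_linear:
  "word_op q w (\<lambda>m. \<Sum>x\<in>A. a x * f x m) = (\<lambda>m. \<Sum>x\<in>A. a x * word_op q w (f x) m)"
  by (induction w) (simp_all add: letter_op_linear)

text \<open>The operators satisfy the defining relation, which lets the action descend to the
  quotient. At \<open>k = 0\<close> the creator term vanishes and [1] = 1; otherwise [k+1] = 1 + q
  [k] is used.\<close>

lemma letter_op_relation: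
  "letter_op q Ann (letter_op q Cre f) m = q * letter_op q Cre (letter_op q Ann f) m + f m"
proof (cases m)
  case (Pair k l)
  show ?thesis
  proof (cases k)
    case 0
    then show ?thesis using Pair by simp
  next
    case (Suc k')
    have "(\<Sum>i\<le>Suc k'. q ^ i) = 1 + q * (\<Sum>i\<le>k'. q ^ i)"
      by (simp add: sum.atMost_Suc_shift sum_distrib_left del: sum.atMost_Suc)
    then show ?thesis using Pair Suc by (simp add: algebra_simps del: sum.atMost_Suc)
  qed
qed

text \<open>Allows elements with different supports to be summed over a common index set.\<close>

lemma free_op_superset:
  assumes "finite A" "Poly_Mapping.keys p \<subseteq> A"
  shows "free_op q p f m = (\<Sum>w\<in>A. Poly_Mapping.lookup p w * word_op q w f m)"
  unfolding free_op_def using assms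
  by (intro sum.mono_neutral_left) (auto simp: in_keys_iff)

lemma free_op_add: "free_op q (p + r) f m = free_op q p f m + free_op q r f m"
proof -
  let ?A = "Poly_Mapping.keys p \<union> Poly_Mapping.keys r"
  have "finite ?A" "Poly_Mapping.keys (p + r) \<subseteq> ?A"
    by (auto simp: keys_add)
  then show ?thesis
    by (simp add: free_op_superset[of ?A] lookup_add distrib_right sum.distrib)
qed

lemma free_op_zero [simp]: "free_op q 0 f m = 0"
  by (simp add: free_op_def)

lemma free_op_uminus: "free_op q (- p) f m = - free_op q p f m"
  using free_op_add[of q p "- p" f m] by (simp add: add_eq_0_iff)

lemma free_op_diff: "free_op q (p - r) f m = free_op q p f m - free_op q r f m"
  using free_op_add[of q p "- r" f m] by (simp add: free_op_uminus)

lemma free_op_sum: "free_op q (\<Sum>x\<in>A. p x) f m = (\<Sum>x\<in>A. free_op q (p x) f m)"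
  by (induction A rule: infinite_finite_induct) (simp_all add: free_op_add)

lemma free_op_single [simp]: "free_op q (Poly_Mapping.single w a) f m = a * word_op q w f m"
  by (simp add: free_op_def)

lemma poly_mapping_eq_sum_single:
  "p = (\<Sum>x\<in>Poly_Mapping.keys p. Poly_Mapping.single x (Poly_Mapping.lookup p x))"
  by (rule poly_mapping_eqI) (auto simp: lookup_sum lookup_single when_def in_keys_iff)

lemma word_op_free_op:
  "word_op q v (free_op q p f) = free_op q (word v * p) f"
proof -
  have "free_op q (word v * p) f = free_op q (word v *
      (\<Sum>w\<in>Poly_Mapping.keys p. Poly_Mapping.single w (Poly_Mapping.lookup p w))) f"
    using poly_mapping_eq_sum_single[of p] by simp
  also have "\<dots> = word_op q v (\<lambda>m. \<Sum>w\<in>Poly_Mapping.keys p. Poly_Mapping.lookup p w * word_op q w f m)"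
    by (simp add: fun_eq_iff sum_distrib_left single_mult_list free_op_sum word_op_linear)
  finally show ?thesis
    by (simp add: free_op_def[abs_def])
qed

text \<open>Both sides are linear in \<open>r\<close>, so one scaled word suffices. Products thus
  act by composition, which lets the elements acting as zero absorb factors on either side.\<close>

lemma free_op_mult: "free_op q (r * p) f = free_op q r (free_op q p f)"
proof
  fix m
  have r: "r = (\<Sum>v\<in>Poly_Mapping.keys r. free_const (Poly_Mapping.lookup r v) * word v)"
    using poly_mapping_eq_sum_single[of r] by (simp add: free_const_def single_mult_list)
  have scale: "free_op q (free_const a * x) g m = a * free_op q x g m" for a x g
  proof -
    have "free_op q (free_const a * x) g m = free_op q (free_const a *
        (\<Sum>w\<in>Poly_Mapping.keys x. Poly_Mapping.single w (Poly_Mapping.lookup x w))) g m"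
      using poly_mapping_eq_sum_single[of x] by simp
    also have "\<dots> = a * free_op q x g m"
      by (simp add: sum_distrib_left free_const_def single_mult_list free_op_sum free_op_def[of q x]
          mult.assoc)
    finally show ?thesis .
  qed
  have "free_op q (r * p) f m =
      free_op q ((\<Sum>v\<in>Poly_Mapping.keys r. free_const (Poly_Mapping.lookup r v) * word v) * p) f m"
    using r by simp
  also have "\<dots> = (\<Sum>v\<in>Poly_Mapping.keys r. Poly_Mapping.lookup r v * word_op q v (free_op q p f) m)"
    by (simp add: sum_distrib_right free_op_sum mult.assoc scale word_op_free_op)
  finally show "free_op q (r * p) f m = free_op q r (free_op q p f) m"
    by (simp add: free_op_def)
qed

lemma free_op_null: "free_op q p (\<lambda>_. 0) = (\<lambda>_. 0)"
proof -
  have "word_op q w (\<lambda>_. 0) = (\<lambda>_. 0)" for w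
    \<comment> \<open>The zero function is the empty linear combination.\<close>
    using word_op_linear[of q w "\<lambda>_. 0" "\<lambda>_ _. 0" "{}"] by simp
  then show ?thesis by (simp add: free_op_def fun_eq_iff)
qed

text \<open>The elements acting as zero form a two-sided ideal that contains the generator, hence
  contain the smallest such ideal.\<close>

lemma free_op_q_ideal:
  assumes "p \<in> q_ideal q"
  shows "free_op q p f m = 0"
proof -
  let ?K = "{p. \<forall>f. free_op q p f = (\<lambda>_. 0)}"
  let ?g = "free_gen Ann * free_gen Cre - free_const q * (free_gen Cre * free_gen Ann) - 1"
  \<comment> \<open>The record defines its additive inverse abstractly; closure under inverses needs
    it as the ordinary minus.\<close>
  have neg: "\<ominus>\<^bsub>free_algebra\<^esub> x = - x" for x
  proof -
    interpret ring free_algebra by (rule ring_free_algebra)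
    have "(- x) \<oplus>\<^bsub>free_algebra\<^esub> x = \<zero>\<^bsub>free_algebra\<^esub>" "x \<in> carrier free_algebra" "- x \<in> carrier free_algebra"
      by (simp_all add: free_algebra_def)
    then show ?thesis by (rule minus_equality)
  qed
  have "ideal ?K free_algebra"
  proof (rule idealI[OF ring_free_algebra])
    show "subgroup ?K (add_monoid free_algebra)"
    proof (unfold_locales)
      fix x assume "x \<in> ?K"
      then show "inv\<^bsub>add_monoid free_algebra\<^esub> x \<in> ?K"
        using neg[of x] by (simp add: a_inv_def fun_eq_iff free_op_uminus)
    qed (auto simp: free_algebra_def fun_eq_iff free_op_add)
  qed (simp_all add: free_algebra_def free_op_mult free_op_null)
  moreover have "?g \<in> ?K"
  proof -
    have "free_op q ?g f m = 0" for f m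
      using letter_op_relation[of q f m]
      by (simp add: free_gen_def free_const_def single_mult_list free_op_diff flip: word_Nil)
    then show ?thesis by (simp add: fun_eq_iff)
  qed
  ultimately have "q_ideal q \<subseteq> ?K"
    unfolding q_ideal_def by (intro ring.genideal_minimal[OF ring_free_algebra]) simp_all
  then have "p \<in> ?K" using assms by (rule subsetD)
  then show ?thesis by simp
qed

lemma free_op_q_class_cong:
  assumes "q_class q p = q_class q r"
  shows "free_op q p f m = free_op q r f m"
  using assms by (elim q_class_eqD) (simp add: free_op_add free_op_q_ideal)

text \<open>The annihilators act first, at creator exponent 0, where the contraction term vanishes
  and the factor is \<open>q ^ 0\<close>; they only raise \<open>l\<close>. The creators then raise
  \<open>k\<close>.\<close>

lemma word_op_normal_word:
  "word_op q (normal_word k l) (\<lambda>m. if m = (0, 0) then 1 else 0) = (\<lambda>m. if m = (k, l) then 1 else 0)"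
proof -
  let ?e = "\<lambda>k l m. if m = (k, l) then 1 else (0::complex)"
  have c: "letter_op q Cre (?e k l) = ?e (Suc k) l" for k l
    by (auto simp: fun_eq_iff)
  have a: "letter_op q Ann (?e 0 l) = ?e 0 (Suc l)" for l
    by (auto simp: fun_eq_iff)
  have "word_op q (replicate l Ann) (?e 0 0) = ?e 0 l"
    by (induction l) (simp_all only: replicate.simps foldr.simps comp_apply id_apply a)
  moreover have "word_op q (replicate k Cre) (?e 0 l) = ?e k l"
    by (induction k) (simp_all only: replicate.simps foldr.simps comp_apply id_apply c)
  ultimately show ?thesis by simp
qed

section \<open>Uniqueness of the normally ordered coefficients\<close>

definition normal_form :: "(nat \<times> nat \<Rightarrow> complex) \<Rightarrow> letter list \<Rightarrow>\<^sub>0 complex" where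
  "normal_form C = (\<Sum>m | C m \<noteq> 0. Poly_Mapping.single (normal_word (fst m) (snd m)) (C m))"

lemma normal_expr_eq_q_class:
  assumes "finite {m. C m \<noteq> 0}"
  shows "normal_expr q C = q_class q (normal_form C)"
  using assms unfolding normal_expr_def normal_form_def
  by (simp only: q_class_sum smult_normal_monomial q_algebra_finsum)

lemma free_op_normal_form:
  assumes "finite {m. C m \<noteq> 0}"
  shows "free_op q (normal_form C) (\<lambda>m. if m = (0, 0) then 1 else 0) = C"
proof
  fix m
  have "free_op q (normal_form C) (\<lambda>m. if m = (0, 0) then 1 else 0) m
      = (\<Sum>n | C n \<noteq> 0. if m = n then C n else 0)"
    unfolding normal_form_def free_op_sum
    by (intro sum.cong refl) (simp only: free_op_single word_op_normal_word, auto)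
  also have "\<dots> = C m" using assms by simp
  finally show "free_op q (normal_form C) (\<lambda>m. if m = (0, 0) then 1 else 0) m = C m" .
qed

text \<open>Acting on the indicator of \<open>(0, 0)\<close> depends only on the class and returns
  the whole coefficient function. This is linear independence of the normally ordered
  monomials.\<close>

lemma normal_expr_inject:
  assumes "finite {m. C m \<noteq> 0}" "finite {m. D m \<noteq> 0}" "normal_expr q C = normal_expr q D"
  shows "C = D"
proof -
  have "q_class q (normal_form C) = q_class q (normal_form D)"
    using assms by (simp add: normal_expr_eq_q_class)
  then have "free_op q (normal_form C) (\<lambda>m. if m = (0, 0) then 1 else 0)
      = free_op q (normal_form D) (\<lambda>m. if m = (0, 0) then 1 else 0)"
    by (intro ext free_op_q_class_cong)
  then show ?thesis using assms by (simp add: free_op_normal_form)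
qed

section \<open>Diagrams on a word with a letter added in front\<close>

text \<open>A left endpoint is an annihilator and a right endpoint a creator, so two edges can only
  meet in endpoints of the same side. Disjointness becomes uniqueness of partners in each
  direction.\<close>

lemma feynman_iff:
  "\<gamma> \<in> feynman w \<longleftrightarrow>
    (\<forall>i j. (i, j) \<in> \<gamma> \<longrightarrow> i < j \<and> j < length w \<and> w ! i = Ann \<and> w ! j = Cre) \<and>
    (\<forall>i j j'. (i, j) \<in> \<gamma> \<longrightarrow> (i, j') \<in> \<gamma> \<longrightarrow> j = j') \<and>
    (\<forall>i i' j. (i, j) \<in> \<gamma> \<longrightarrow> (i', j) \<in> \<gamma> \<longrightarrow> i = i')"
  (is "_ \<longleftrightarrow> ?T \<and> ?L \<and> ?R")
proof
  assume *: "\<gamma> \<in> feynman w"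
  then have d: "\<And>i j i' j'. (i, j) \<in> \<gamma> \<Longrightarrow> (i', j') \<in> \<gamma> \<Longrightarrow> (i, j) \<noteq> (i', j') \<Longrightarrow> {i, j} \<inter> {i', j'} = {}"
    unfolding feynman_def by force
  have ?T using * unfolding feynman_def by auto
  moreover have ?L using d by blast
  moreover have ?R using d by blast
  ultimately show "?T \<and> ?L \<and> ?R" by blast
next
  assume *: "?T \<and> ?L \<and> ?R"
  have "{i, j} \<inter> {i', j'} = {}" if "(i, j) \<in> \<gamma>" "(i', j') \<in> \<gamma>" "(i, j) \<noteq> (i', j')" for i j i' j'
  proof -
    have "i = i' \<longrightarrow> j = j'" "j = j' \<longrightarrow> i = i'" using * that by blast+
    moreover have "i \<noteq> j'" "i' \<noteq> j" using * that by (metis letter.distinct(1))+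
    ultimately show ?thesis using that(3) by auto
  qed
  then have "\<forall>e\<in>\<gamma>. \<forall>e'\<in>\<gamma>. e \<noteq> e' \<longrightarrow> {fst e, snd e} \<inter> {fst e', snd e'} = {}"
    by (metis prod.collapse)
  then show "\<gamma> \<in> feynman w"
    using * unfolding feynman_def by blast
qed

lemma feynman_subset: "\<gamma> \<in> feynman w \<Longrightarrow> \<gamma> \<subseteq> {..<length w} \<times> {..<length w}"
  unfolding feynman_iff by (auto intro: less_trans)

lemma finite_feynman_diagram: "\<gamma> \<in> feynman w \<Longrightarrow> finite \<gamma>"
  using feynman_subset finite_subset by blast

lemma finite_feynman: "finite (feynman w)"
  by (rule finite_subset[of _ "Pow ({..<length w} \<times> {..<length w})"]) (auto dest: feynman_subset)

lemma singletons_iff: "k \<in> singletons w \<gamma> \<longleftrightarrow> k < length w \<and> (\<forall>i. (k, i) \<notin> \<gamma> \<and> (i, k) \<notin> \<gamma>)"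
  by (auto simp: singletons_def)

lemma finite_singletons: "finite (singletons w \<gamma>)"
  by (simp add: singletons_def)

lemma finite_singletons_of: "finite (singletons_of s w \<gamma>)"
  by (simp add: singletons_of_def finite_singletons)

text \<open>Words grow on the left, so old vertices move up by one and vertex 0 is reserved for the
  new letter.\<close>

definition shift :: "(nat \<times> nat) set \<Rightarrow> (nat \<times> nat) set" where
  "shift \<gamma> = map_prod Suc Suc ` \<gamma>"

lemma shift_iff [simp]:
  "(Suc i, Suc j) \<in> shift \<gamma> \<longleftrightarrow> (i, j) \<in> \<gamma>" "(0, k) \<notin> shift \<gamma>" "(k, 0) \<notin> shift \<gamma>"
  by (auto simp: shift_def)

lemma shift_cases: "e \<in> shift \<gamma> \<longleftrightarrow> (\<exists>i j. e = (Suc i, Suc j) \<and> (i, j) \<in> \<gamma>)"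
  by (auto simp: shift_def)

lemma inj_shift: "inj shift"
  by (rule injI) (simp add: shift_def inj_image_eq_iff prod.inj_map)

lemma shift_in_feynman_iff: "shift \<gamma> \<in> feynman (s # w) \<longleftrightarrow> \<gamma> \<in> feynman w"
proof
  assume *: "shift \<gamma> \<in> feynman (s # w)"
  show "\<gamma> \<in> feynman w"
    unfolding feynman_iff
  proof (intro conjI allI impI)
    fix i j assume "(i, j) \<in> \<gamma>"
    then have "(Suc i, Suc j) \<in> shift \<gamma>" by simp
    then have "Suc i < Suc j \<and> Suc j < length (s # w) \<and> (s # w) ! Suc i = Ann \<and> (s # w) ! Suc j = Cre"
      using * unfolding feynman_iff by blast
    then show "i < j" "j < length w" "w ! i = Ann" "w ! j = Cre" by simp_all
  next
    fix i j j' assume "(i, j) \<in> \<gamma>" "(i, j') \<in> \<gamma>"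
    then have "(Suc i, Suc j) \<in> shift \<gamma>" "(Suc i, Suc j') \<in> shift \<gamma>" by simp_all
    then have "Suc j = Suc j'" using * unfolding feynman_iff by blast
    then show "j = j'" by simp
  next
    fix i i' j assume "(i, j) \<in> \<gamma>" "(i', j) \<in> \<gamma>"
    then have "(Suc i, Suc j) \<in> shift \<gamma>" "(Suc i', Suc j) \<in> shift \<gamma>" by simp_all
    then have "Suc i = Suc i'" using * unfolding feynman_iff by blast
    then show "i = i'" by simp
  qed
next
  assume "\<gamma> \<in> feynman w"
  then show "shift \<gamma> \<in> feynman (s # w)"
    unfolding feynman_iff shift_cases by fastforce
qed

text \<open>No edge can end at vertex 0 either, since its left endpoint would be smaller; so both
  ends of every edge are successors.\<close>

lemma feynman_Cons_no_first:
  assumes "\<delta> \<in> feynman (s # w)" "\<And>j. (0, j) \<notin> \<delta>"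
  shows "\<delta> \<in> shift ` feynman w"
proof -
  define \<gamma> where "\<gamma> = {(i, j). (Suc i, Suc j) \<in> \<delta>}"
  have eq: "\<delta> = shift \<gamma>"
  proof (rule Set.set_eqI)
    fix e show "e \<in> \<delta> \<longleftrightarrow> e \<in> shift \<gamma>"
    proof (cases e)
      case (Pair i j)
      have "j \<noteq> 0" if "(i, j) \<in> \<delta>"
        using assms(1) that unfolding feynman_iff by (metis less_nat_zero_code)
      then show ?thesis
        using assms(2)[of j] Pair by (cases i; cases j) (auto simp: \<gamma>_def)
    qed
  qed
  have "\<gamma> \<in> feynman w" using assms(1) unfolding eq shift_in_feynman_iff .
  then show ?thesis unfolding eq by (rule imageI)
qed

lemma feynman_Cons_Cre: "feynman (Cre # w) = shift ` feynman w"
proof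
  show "feynman (Cre # w) \<subseteq> shift ` feynman w"
  proof
    fix \<delta> assume d: "\<delta> \<in> feynman (Cre # w)"
    then have "(0, j) \<notin> \<delta>" for j unfolding feynman_iff by (metis letter.distinct(1) nth_Cons_0)
    with d show "\<delta> \<in> shift ` feynman w" by (rule feynman_Cons_no_first)
  qed
qed (auto simp: shift_in_feynman_iff)

lemma insert_edge_in_feynman:
  assumes "\<gamma> \<in> feynman w" "j \<in> singletons_of Cre w \<gamma>"
  shows "insert (0, Suc j) (shift \<gamma>) \<in> feynman (Ann # w)"
proof -
  have "shift \<gamma> \<in> feynman (Ann # w)"
    using assms by (simp add: shift_in_feynman_iff)
  moreover have "(i, Suc j) \<notin> shift \<gamma>" for i
    using assms(2) by (auto simp: shift_cases singletons_of_def singletons_iff)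
  moreover have "w ! j = Cre" "j < length w"
    using assms(2) by (auto simp: singletons_of_def singletons_iff)
  ultimately show ?thesis
    unfolding feynman_iff by auto
qed

text \<open>Vertex 0 is single or has exactly one edge. Deleting that edge leaves a shifted diagram
  in which the former partner is a single creator.\<close>

lemma feynman_Cons_Ann:
  "feynman (Ann # w) = shift ` feynman w \<union>
    (\<lambda>(\<gamma>, j). insert (0, Suc j) (shift \<gamma>)) ` (SIGMA \<gamma>:feynman w. singletons_of Cre w \<gamma>)"
proof
  show "feynman (Ann # w) \<subseteq> shift ` feynman w \<union>
    (\<lambda>(\<gamma>, j). insert (0, Suc j) (shift \<gamma>)) ` (SIGMA \<gamma>:feynman w. singletons_of Cre w \<gamma>)"
  proof
    fix \<delta> assume d: "\<delta> \<in> feynman (Ann # w)"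
    show "\<delta> \<in> shift ` feynman w \<union>
      (\<lambda>(\<gamma>, j). insert (0, Suc j) (shift \<gamma>)) ` (SIGMA \<gamma>:feynman w. singletons_of Cre w \<gamma>)"
    proof (cases "\<exists>j. (0, j) \<in> \<delta>")
      case False
      with d show ?thesis using feynman_Cons_no_first by blast
    next
      case True
      then obtain j' where "(0, j') \<in> \<delta>" by blast
      moreover from this obtain j where "j' = Suc j"
        using d unfolding feynman_iff by (metis less_nat_zero_code not0_implies_Suc)
      ultimately have j: "(0, Suc j) \<in> \<delta>" by simp
      have "\<delta> - {(0, Suc j)} \<in> feynman (Ann # w)"
        using d unfolding feynman_iff by blast
      moreover have "(0, i) \<notin> \<delta> - {(0, Suc j)}" for i
        using d j unfolding feynman_iff by blast
      ultimately obtain \<gamma> where g: "\<gamma> \<in> feynman w" "\<delta> - {(0, Suc j)} = shift \<gamma>"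
        using feynman_Cons_no_first by blast
      \<comment> \<open>Otherwise \<open>Suc j\<close> would have a second left partner besides 0,
        or be an annihilator.\<close>
      have "(i, j) \<notin> \<gamma>" "(j, i) \<notin> \<gamma>" for i
      proof -
        have "(i, j) \<in> \<gamma> \<Longrightarrow> (Suc i, Suc j) \<in> \<delta>" "(j, i) \<in> \<gamma> \<Longrightarrow> (Suc j, Suc i) \<in> \<delta>"
          using g(2) by (metis DiffD1 shift_iff(1))+
        then show "(i, j) \<notin> \<gamma>" "(j, i) \<notin> \<gamma>"
          using d j unfolding feynman_iff by (metis nat.distinct(1), metis letter.distinct(1))
      qed
      moreover have "j < length w" "w ! j = Cre"
        using d j unfolding feynman_iff by fastforce+
      ultimately have "j \<in> singletons_of Cre w \<gamma>"
        by (simp add: singletons_of_def singletons_iff)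
      moreover have "\<delta> = insert (0, Suc j) (shift \<gamma>)"
        using g(2) j by blast
      ultimately show ?thesis using g(1) by blast
    qed
  qed
qed (auto simp: shift_in_feynman_iff insert_edge_in_feynman)

text \<open>The edge at 0 determines \<open>j\<close>, and the edges between positive vertices
  determine \<gamma>.\<close>

lemma inj_on_insert_edge:
  "inj_on (\<lambda>(\<gamma>, j). insert (0, Suc j) (shift \<gamma>)) A"
proof (rule inj_onI)
  fix x y assume "(\<lambda>(\<gamma>, j). insert (0, Suc j) (shift \<gamma>)) x = (\<lambda>(\<gamma>, j). insert (0, Suc j) (shift \<gamma>)) y"
  then obtain \<gamma> j \<gamma>' j' where xy: "x = (\<gamma>, j)" "y = (\<gamma>', j')"
    and eq: "insert (0, Suc j) (shift \<gamma>) = insert (0, Suc j') (shift \<gamma>')"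
    by (cases x; cases y) simp
  have mem: "e \<in> insert (0, Suc j) (shift \<gamma>) \<longleftrightarrow> e \<in> insert (0, Suc j') (shift \<gamma>')" for e
    by (simp only: eq)
  have "j = j'"
    using mem[of "(0, Suc j)"] by simp
  moreover have "(i, k) \<in> \<gamma> \<longleftrightarrow> (i, k) \<in> \<gamma>'" for i k
    using mem[of "(Suc i, Suc k)"] by simp
  ultimately show "x = y"
    unfolding xy by auto
qed

section \<open>Singletons, crossings and length after adding a letter in front\<close>

lemma singletons_shift: "singletons (s # w) (shift \<gamma>) = insert 0 (Suc ` singletons w \<gamma>)"
proof (rule Set.set_eqI)
  fix k show "k \<in> singletons (s # w) (shift \<gamma>) \<longleftrightarrow> k \<in> insert 0 (Suc ` singletons w \<gamma>)"
    by (cases k) (auto simp: singletons_iff shift_cases)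
qed

lemma singletons_of_shift:
  "singletons_of t (s # w) (shift \<gamma>) =
    (if s = t then insert 0 (Suc ` singletons_of t w \<gamma>) else Suc ` singletons_of t w \<gamma>)"
  by (auto simp: singletons_of_def singletons_shift)

lemma singletons_insert_edge:
  assumes "j \<in> singletons w \<gamma>"
  shows "singletons (Ann # w) (insert (0, Suc j) (shift \<gamma>)) = Suc ` (singletons w \<gamma> - {j})"
proof (rule Set.set_eqI)
  fix k show "k \<in> singletons (Ann # w) (insert (0, Suc j) (shift \<gamma>)) \<longleftrightarrow> k \<in> Suc ` (singletons w \<gamma> - {j})"
    by (cases k) (auto simp: singletons_iff shift_cases)
qed

lemma singletons_of_insert_edge:
  assumes "j \<in> singletons_of Cre w \<gamma>"
  shows "singletons_of t (Ann # w) (insert (0, Suc j) (shift \<gamma>)) =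
    Suc ` (singletons_of t w \<gamma> - {j})"
  using assms by (auto simp: singletons_of_def singletons_insert_edge)

lemma crossings_shift: "crossings (shift \<gamma>) = crossings \<gamma>"
  unfolding crossings_def
  by (rule sym, rule bij_betw_same_card[of "map_prod (map_prod Suc Suc) (map_prod Suc Suc)"])
    (auto simp: bij_betw_def inj_on_def shift_cases image_iff)

lemma degenerate_crossings_shift: "degenerate_crossings (s # w) (shift \<gamma>) = degenerate_crossings w \<gamma>"
  unfolding degenerate_crossings_def
  by (rule sym, rule bij_betw_same_card[of "map_prod Suc (map_prod Suc Suc)"])
    (auto simp: bij_betw_def inj_on_def shift_cases image_iff singletons_shift)

lemma finite_singleton_pairs:
  "finite {(k, k'). k < k' \<and> k \<in> singletons_of Ann w \<gamma> \<and> k' \<in> singletons_of Cre w \<gamma>}"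
  by (rule finite_subset[of _ "singletons_of Ann w \<gamma> \<times> singletons_of Cre w \<gamma>"])
    (auto simp: finite_singletons_of)

text \<open>A new single annihilator precedes every single creator and forms one pair with each; a
  new creator in first position ends no pair.\<close>

lemma diagram_length_shift:
  "diagram_length (s # w) (shift \<gamma>) =
    diagram_length w \<gamma> + (if s = Ann then card (singletons_of Cre w \<gamma>) else 0)"
proof -
  let ?P = "{(k, k'). k < k' \<and> k \<in> singletons_of Ann w \<gamma> \<and> k' \<in> singletons_of Cre w \<gamma>}"
  let ?Q = "if s = Ann then Pair (0::nat) ` Suc ` singletons_of Cre w \<gamma> else {}"
  have "{(k, k'). k < k' \<and> k \<in> singletons_of Ann (s # w) (shift \<gamma>)
        \<and> k' \<in> singletons_of Cre (s # w) (shift \<gamma>)} = map_prod Suc Suc ` ?P \<union> ?Q"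
    by (cases s) (auto simp: singletons_of_shift)
  moreover have "card (map_prod Suc Suc ` ?P \<union> ?Q) = card (map_prod Suc Suc ` ?P) + card ?Q"
    by (intro card_Un_disjoint) (auto simp: finite_singletons_of intro!: finite_imageI finite_singleton_pairs)
  moreover have "card (map_prod Suc Suc ` ?P) = card ?P"
    by (intro card_image) (auto simp: inj_on_def)
  moreover have "card (Pair (0::nat) ` Suc ` singletons_of Cre w \<gamma>) = card (singletons_of Cre w \<gamma>)"
    by (simp add: card_image inj_on_def)
  ultimately show ?thesis by (simp add: diagram_length_def)
qed

text \<open>Starting at 0, the new edge can only be the left one of a crossing; it is crossed by
  exactly the old edges that pass over \<open>j\<close>.\<close>

lemma crossings_insert_edge:
  assumes "finite \<gamma>"
  shows "crossings (insert (0, Suc j) (shift \<gamma>)) =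
    crossings \<gamma> + card {(i, i') \<in> \<gamma>. i < j \<and> j < i'}"
proof -
  let ?P = "{((i, j), (i', j')). (i, j) \<in> shift \<gamma> \<and> (i', j') \<in> shift \<gamma> \<and> i < i' \<and> i' < j \<and> j < j'}"
  let ?N = "{(i, i') \<in> \<gamma>. i < j \<and> j < i'}"
  have fin: "finite (shift \<gamma>)" using assms by (simp add: shift_def)
  have "{((a, b), (a', b')). (a, b) \<in> insert (0, Suc j) (shift \<gamma>) \<and> (a', b') \<in> insert (0, Suc j) (shift \<gamma>)
      \<and> a < a' \<and> a' < b \<and> b < b'} = ?P \<union> (\<lambda>e. ((0, Suc j), map_prod Suc Suc e)) ` ?N"
    by (auto simp: shift_cases image_iff)
  moreover have "finite ?P"
    by (rule finite_subset[of _ "shift \<gamma> \<times> shift \<gamma>"]) (auto simp: fin)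
  moreover have "finite ?N" using assms by (rule finite_subset[rotated]) auto
  moreover have "?P \<inter> (\<lambda>e. ((0, Suc j), map_prod Suc Suc e)) ` ?N = {}"
    by auto
  moreover have "card ((\<lambda>e. ((0::nat, Suc j), map_prod Suc Suc e)) ` ?N) = card ?N"
    by (intro card_image) (auto simp: inj_on_def)
  ultimately have "crossings (insert (0, Suc j) (shift \<gamma>)) = crossings (shift \<gamma>) + card ?N"
    by (simp add: crossings_def card_Un_disjoint)
  then show ?thesis by (simp add: crossings_shift)
qed

text \<open>Each edge over \<open>j\<close> loses the triple with middle \<open>j\<close>, and the
  new edge gains one for each remaining singleton below it. The additive form avoids truncated
  subtraction.\<close>

lemma degenerate_crossings_insert_edge:
  assumes "finite \<gamma>" "j \<in> singletons w \<gamma>"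
  shows "degenerate_crossings (Ann # w) (insert (0, Suc j) (shift \<gamma>)) + card {(i, i') \<in> \<gamma>. i < j \<and> j < i'} =
    degenerate_crossings w \<gamma> + card {k \<in> singletons w \<gamma>. k < j}"
proof -
  \<comment> \<open>The triples with middle vertex other than \<open>j\<close> are common to both
    diagrams up to the shift; each count is compared with them.\<close>
  let ?D = "{(i, k, i'). i < k \<and> k < i' \<and> (i, i') \<in> \<gamma> \<and> k \<in> singletons w \<gamma> - {j}}"
  let ?N = "{(i, i') \<in> \<gamma>. i < j \<and> j < i'}"
  let ?K = "{k \<in> singletons w \<gamma>. k < j}"
  have D: "finite ?D"
    by (rule finite_subset[of _ "fst ` \<gamma> \<times> singletons w \<gamma> \<times> snd ` \<gamma>"])
      (force, simp add: assms(1) finite_singletons)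
  have N: "finite ?N" using assms(1) by (rule finite_subset[rotated]) auto
  have K: "finite ?K" by (simp add: finite_singletons)
  have "{(i, k, i'). i < k \<and> k < i' \<and> (i, i') \<in> \<gamma> \<and> k \<in> singletons w \<gamma>} = ?D \<union> (\<lambda>(i, i'). (i, j, i')) ` ?N"
    using assms(2) by (auto simp: image_iff)
  moreover have "card (?D \<union> (\<lambda>(i, i'). (i, j, i')) ` ?N) = card ?D + card ((\<lambda>(i, i'). (i, j, i')) ` ?N)"
    by (intro card_Un_disjoint) (use D N in auto)
  moreover have "card ((\<lambda>(i, i'). (i, j, i')) ` ?N) = card ?N"
    by (intro card_image) (auto simp: inj_on_def)
  ultimately have 1: "degenerate_crossings w \<gamma> = card ?D + card ?N"
    by (simp add: degenerate_crossings_def)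
  have "{(i, k, i'). i < k \<and> k < i' \<and> (i, i') \<in> insert (0, Suc j) (shift \<gamma>) \<and>
      k \<in> singletons (Ann # w) (insert (0, Suc j) (shift \<gamma>))} =
      map_prod Suc (map_prod Suc Suc) ` ?D \<union> (\<lambda>k. (0, Suc k, Suc j)) ` ?K"
    using assms(2) by (auto simp: image_iff shift_cases singletons_insert_edge)
  moreover have "card (map_prod Suc (map_prod Suc Suc) ` ?D \<union> (\<lambda>k. (0, Suc k, Suc j)) ` ?K)
      = card (map_prod Suc (map_prod Suc Suc) ` ?D) + card ((\<lambda>k. (0::nat, Suc k, Suc j)) ` ?K)"
    by (intro card_Un_disjoint) (use D K in auto)
  moreover have "card (map_prod Suc (map_prod Suc Suc) ` ?D) = card ?D"
    by (intro card_image) (auto simp: inj_on_def)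
  moreover have "card ((\<lambda>k. (0::nat, Suc k, Suc j)) ` ?K) = card ?K"
    by (intro card_image) (auto simp: inj_on_def)
  ultimately have "degenerate_crossings (Ann # w) (insert (0, Suc j) (shift \<gamma>)) = card ?D + card ?K"
    by (simp add: degenerate_crossings_def)
  with 1 show ?thesis by simp
qed

text \<open>The pairs lost are those ending in \<open>j\<close>: being a creator, \<open>j\<close>
  starts none. Vertex 0 is not single and adds none.\<close>

lemma diagram_length_insert_edge:
  assumes "j \<in> singletons_of Cre w \<gamma>"
  shows "diagram_length (Ann # w) (insert (0, Suc j) (shift \<gamma>)) + card {k \<in> singletons_of Ann w \<gamma>. k < j} =
    diagram_length w \<gamma>"
proof -
  let ?P = "{(k, k'). k < k' \<and> k \<in> singletons_of Ann w \<gamma> \<and> k' \<in> singletons_of Cre w \<gamma> - {j}}"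
  let ?K = "{k \<in> singletons_of Ann w \<gamma>. k < j}"
  have P: "finite ?P"
    by (rule finite_subset[OF _ finite_singleton_pairs[of w \<gamma>]]) auto
  have ann: "j \<notin> singletons_of Ann w \<gamma>"
    using assms by (simp add: singletons_of_def)
  have "{(k, k'). k < k' \<and> k \<in> singletons_of Ann w \<gamma> \<and> k' \<in> singletons_of Cre w \<gamma>} = ?P \<union> (\<lambda>k. (k, j)) ` ?K"
    using assms by auto
  moreover have "card (?P \<union> (\<lambda>k. (k, j)) ` ?K) = card ?P + card ((\<lambda>k. (k, j)) ` ?K)"
    by (intro card_Un_disjoint) (use P in \<open>auto simp: finite_singletons_of\<close>)
  moreover have "card ((\<lambda>k. (k, j)) ` ?K) = card ?K"
    by (intro card_image) (auto simp: inj_on_def)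
  ultimately have 1: "diagram_length w \<gamma> = card ?P + card ?K"
    by (simp add: diagram_length_def)
  have "{(k, k'). k < k' \<and> k \<in> singletons_of Ann (Ann # w) (insert (0, Suc j) (shift \<gamma>)) \<and>
      k' \<in> singletons_of Cre (Ann # w) (insert (0, Suc j) (shift \<gamma>))} = map_prod Suc Suc ` ?P"
    using ann by (auto simp: singletons_of_insert_edge[OF assms] image_iff)
  moreover have "card (map_prod Suc Suc ` ?P) = card ?P"
    by (intro card_image) (auto simp: inj_on_def)
  ultimately have "diagram_length (Ann # w) (insert (0, Suc j) (shift \<gamma>)) = card ?P"
    by (simp add: diagram_length_def)
  with 1 show ?thesis by simp
qed

lemma q_weight_shift_Cre: "q_weight q (Cre # w) (shift \<gamma>) = q_weight q w \<gamma>"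
  by (simp add: q_weight_def total_crossings_def crossings_shift degenerate_crossings_shift
      diagram_length_shift)

lemma q_weight_shift_Ann:
  "q_weight q (Ann # w) (shift \<gamma>) = q_weight q w \<gamma> * q ^ card (singletons_of Cre w \<gamma>)"
  by (simp add: q_weight_def total_crossings_def crossings_shift degenerate_crossings_shift
      diagram_length_shift power_add)

text \<open>
  Contracting the new vertex with the creator \<open>j\<close> turns each degenerate crossing of an
  edge over \<open>j\<close> into a crossing with the new edge, and each pair counted by the length
  that ends in \<open>j\<close> into a degenerate crossing of the new edge; only the single
  creators left of \<open>j\<close> contribute anything new.
\<close>

lemma q_weight_insert_edge:
  assumes "\<gamma> \<in> feynman w" "j \<in> singletons_of Cre w \<gamma>"
  shows "q_weight q (Ann # w) (insert (0, Suc j) (shift \<gamma>)) =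
    q_weight q w \<gamma> * q ^ card {k \<in> singletons_of Cre w \<gamma>. k < j}"
proof -
  have fin: "finite \<gamma>" using assms(1) by (rule finite_feynman_diagram)
  have j: "j \<in> singletons w \<gamma>" using assms(2) by (simp add: singletons_of_def)
  have "{k \<in> singletons w \<gamma>. k < j} =
      {k \<in> singletons_of Ann w \<gamma>. k < j} \<union> {k \<in> singletons_of Cre w \<gamma>. k < j}"
    by (auto simp: singletons_of_def intro: letter.exhaust)
  moreover have "{k \<in> singletons_of Ann w \<gamma>. k < j} \<inter> {k \<in> singletons_of Cre w \<gamma>. k < j} = {}"
    by (auto simp: singletons_of_def)
  ultimately have "card {k \<in> singletons w \<gamma>. k < j} =
      card {k \<in> singletons_of Ann w \<gamma>. k < j} + card {k \<in> singletons_of Cre w \<gamma>. k < j}"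
    by (simp only:) (intro card_Un_disjoint, simp_all add: finite_singletons_of)
  then have "total_crossings (Ann # w) (insert (0, Suc j) (shift \<gamma>)) + diagram_length (Ann # w) (insert (0, Suc j) (shift \<gamma>))
      = total_crossings w \<gamma> + diagram_length w \<gamma> + card {k \<in> singletons_of Cre w \<gamma>. k < j}"
    using crossings_insert_edge[OF fin, of j] degenerate_crossings_insert_edge[OF fin j]
      diagram_length_insert_edge[OF assms(2)]
    unfolding total_crossings_def by linarith
  then show ?thesis by (simp add: q_weight_def power_add)
qed

text \<open>The exponents are the ranks in \<open>S\<close>, which run through 0, ...,
  \<open>card S - 1\<close>. Adding a new maximum leaves the old ranks alone and adds the rank
  \<open>card A\<close>.\<close>

lemma sum_power_rank:
  fixes q :: "'a::comm_semiring_1" and S :: "'b::linorder set"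
  assumes "finite S"
  shows "(\<Sum>j\<in>S. q ^ card {k \<in> S. k < j}) = (\<Sum>i<card S. q ^ i)"
  using assms
proof (induction S rule: finite_linorder_max_induct)
  case empty
  then show ?case by simp
next
  case (insert b A)
  have less: "a < b" if "a \<in> A" for a using insert.hyps(2) that by blast
  then have b: "b \<notin> A" by blast
  have "{k \<in> insert b A. k < b} = A" using less by blast
  moreover have "(\<Sum>j\<in>A. q ^ card {k \<in> insert b A. k < j}) = (\<Sum>j\<in>A. q ^ card {k \<in> A. k < j})"
  proof (rule sum.cong[OF refl])
    fix j assume "j \<in> A"
    then have "{k \<in> insert b A. k < j} = {k \<in> A. k < j}" using less less_asym by blast
    then show "q ^ card {k \<in> insert b A. k < j} = q ^ card {k \<in> A. k < j}" by (simp only:)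
  qed
  ultimately have "(\<Sum>j\<in>insert b A. q ^ card {k \<in> insert b A. k < j}) =
      q ^ card A + (\<Sum>j\<in>A. q ^ card {k \<in> A. k < j})"
    by (simp only: sum.insert[OF insert.hyps(1) b])
  also have "\<dots> = (\<Sum>i<card (insert b A). q ^ i)"
    using insert.hyps(1) b insert.IH by (simp add: add.commute)
  finally show ?case .
qed

section \<open>The expansion over Feynman diagrams\<close>

lemma single_sum:
  "Poly_Mapping.single v (\<Sum>x\<in>A. f x) = (\<Sum>x\<in>A. Poly_Mapping.single v (f x))"
  by (induction A rule: infinite_finite_induct) (simp_all add: single_add)

text \<open>Free-algebra representative of the weighted double dot monomial.\<close>

definition diagram_term :: "complex \<Rightarrow> letter list \<Rightarrow> (nat \<times> nat) set \<Rightarrow> letter list \<Rightarrow>\<^sub>0 complex" where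
  "diagram_term q w \<gamma> = Poly_Mapping.single
     (normal_word (card (singletons_of Cre w \<gamma>)) (card (singletons_of Ann w \<gamma>))) (q_weight q w \<gamma>)"

lemma diagram_term_shift_Cre:
  "diagram_term q (Cre # w) (shift \<gamma>) = word [Cre] * diagram_term q w \<gamma>"
  by (simp add: diagram_term_def single_mult_list q_weight_shift_Cre singletons_of_shift
      card_image finite_singletons_of)

lemma diagram_term_shift_Ann:
  "diagram_term q (Ann # w) (shift \<gamma>) = Poly_Mapping.single
     (normal_word (card (singletons_of Cre w \<gamma>)) (Suc (card (singletons_of Ann w \<gamma>))))
     (q_weight q w \<gamma> * q ^ card (singletons_of Cre w \<gamma>))"
  by (simp add: diagram_term_def q_weight_shift_Ann singletons_of_shift card_image finite_singletons_of
      del: replicate_Suc)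

lemma diagram_term_insert_edge:
  assumes "\<gamma> \<in> feynman w" "j \<in> singletons_of Cre w \<gamma>"
  shows "diagram_term q (Ann # w) (insert (0, Suc j) (shift \<gamma>)) = Poly_Mapping.single
     (normal_word (card (singletons_of Cre w \<gamma>) - 1) (card (singletons_of Ann w \<gamma>)))
     (q_weight q w \<gamma> * q ^ card {k \<in> singletons_of Cre w \<gamma>. k < j})"
proof -
  have "j \<notin> singletons_of Ann w \<gamma>" using assms(2) by (simp add: singletons_of_def)
  then show ?thesis
    by (simp add: diagram_term_def q_weight_insert_edge[OF assms] singletons_of_insert_edge[OF assms(2)]
        card_image assms(2))
qed

text \<open>All contractions give the same monomial, and their rank weights sum to the q-number of
  the commutation rule; leaving vertex 0 single gives its other term.\<close>

lemma q_class_annihilator_diagram_term: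
  assumes "\<gamma> \<in> feynman w"
  shows "q_class q (word [Ann] * diagram_term q w \<gamma>) = q_class q (diagram_term q (Ann # w) (shift \<gamma>)
    + (\<Sum>j\<in>singletons_of Cre w \<gamma>. diagram_term q (Ann # w) (insert (0, Suc j) (shift \<gamma>))))"
proof -
  let ?r = "card (singletons_of Cre w \<gamma>)" and ?l = "card (singletons_of Ann w \<gamma>)"
  have "(\<Sum>j\<in>singletons_of Cre w \<gamma>. diagram_term q (Ann # w) (insert (0, Suc j) (shift \<gamma>))) =
      Poly_Mapping.single (normal_word (?r - 1) ?l) (q_weight q w \<gamma> * (\<Sum>i<?r. q ^ i))"
    by (simp add: diagram_term_insert_edge[OF assms] sum_power_rank finite_singletons_of
        flip: single_sum sum_distrib_left)
  moreover have "word [Ann] * diagram_term q w \<gamma> =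
      Poly_Mapping.single (Ann # normal_word ?r ?l) (q_weight q w \<gamma>)"
    by (simp add: diagram_term_def single_mult_list)
  ultimately show ?thesis
    by (simp only: diagram_term_shift_Ann q_class_annihilator_normal_word)
qed

text \<open>Both parametrizations are injective, and their images are disjoint since a shifted
  diagram has no edge at 0.\<close>

lemma sum_feynman_Cons_Ann:
  fixes f :: "(nat \<times> nat) set \<Rightarrow> 'a::comm_monoid_add"
  shows "(\<Sum>\<gamma>\<in>feynman (Ann # w). f \<gamma>) =
    (\<Sum>\<gamma>\<in>feynman w. f (shift \<gamma>) + (\<Sum>j\<in>singletons_of Cre w \<gamma>. f (insert (0, Suc j) (shift \<gamma>))))"
proof -
  let ?S = "SIGMA \<gamma>:feynman w. singletons_of Cre w \<gamma>"
  let ?g = "\<lambda>(\<gamma>, j). insert (0, Suc j) (shift \<gamma>)"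
  have "shift \<gamma> \<noteq> insert (0, Suc j) (shift \<gamma>')" for \<gamma> \<gamma>' j
  proof
    assume "shift \<gamma> = insert (0, Suc j) (shift \<gamma>')"
    then have "(0, Suc j) \<in> shift \<gamma>" by simp
    then show False by simp
  qed
  then have "(\<Sum>\<gamma>\<in>feynman (Ann # w). f \<gamma>) = sum f (shift ` feynman w) + sum f (?g ` ?S)"
    unfolding feynman_Cons_Ann
    by (intro sum.union_disjoint) (auto simp: finite_feynman finite_singletons_of)
  also have "sum f (shift ` feynman w) = (\<Sum>\<gamma>\<in>feynman w. f (shift \<gamma>))"
    using inj_shift by (simp add: sum.reindex inj_on_subset[OF inj_shift])
  also have "sum f (?g ` ?S) = (\<Sum>(\<gamma>, j)\<in>?S. f (insert (0, Suc j) (shift \<gamma>)))"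
    unfolding sum.reindex[OF inj_on_insert_edge] by (simp add: case_prod_beta comp_def)
  also have "\<dots> = (\<Sum>\<gamma>\<in>feynman w. \<Sum>j\<in>singletons_of Cre w \<gamma>. f (insert (0, Suc j) (shift \<gamma>)))"
    by (simp add: sum.Sigma finite_feynman finite_singletons_of)
  finally show ?thesis by (simp add: sum.distrib)
qed

lemma q_class_word_eq_feynman_sum:
  "q_class q (word w) = q_class q (\<Sum>\<gamma>\<in>feynman w. diagram_term q w \<gamma>)"
proof (induction w)
  case Nil
  have "feynman [] = {{}}" by (auto simp: feynman_iff)
  then show ?case
    by (simp add: diagram_term_def singletons_of_def singletons_def q_weight_def total_crossings_def
        crossings_def degenerate_crossings_def diagram_length_def case_prod_unfold)
next
  case (Cons s w)
  have "q_class q (word (s # w)) = q_class q (word [s] * word w)"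
    by (simp add: single_mult_list)
  also have "\<dots> = q_class q (word [s] * (\<Sum>\<gamma>\<in>feynman w. diagram_term q w \<gamma>))"
    by (simp only: q_class_mult Cons.IH)
  also have "\<dots> = q_class q (\<Sum>\<gamma>\<in>feynman w. word [s] * diagram_term q w \<gamma>)"
    by (simp add: sum_distrib_left)
  also have "\<dots> = q_class q (\<Sum>\<gamma>\<in>feynman (s # w). diagram_term q (s # w) \<gamma>)"
  proof (cases s)
    case Cre
    then show ?thesis
      by (simp add: feynman_Cons_Cre sum.reindex inj_on_subset[OF inj_shift] diagram_term_shift_Cre)
  next
    case Ann
    \<comment> \<open>Unlike for a creator, the summands are compared only modulo the ideal, so this
      is done under \<open>q_class\<close>, one old diagram at a time.\<close>
    then show ?thesis
      unfolding Ann sum_feynman_Cons_Ann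
      by (intro q_class_sum_cong q_class_annihilator_diagram_term)
  qed
  finally show ?case .
qed

section \<open>Collecting diagrams by their numbers of singletons\<close>

definition feynman_coeff :: "complex \<Rightarrow> letter list \<Rightarrow> nat \<times> nat \<Rightarrow> complex" where
  "feynman_coeff q w m = (\<Sum>\<gamma> | \<gamma> \<in> feynman w \<and> card (singletons_of Cre w \<gamma>) = fst m
     \<and> card (singletons_of Ann w \<gamma>) = snd m. q_weight q w \<gamma>)"

text \<open>A nonzero coefficient needs some diagram with these counts, which makes the support
  finite. The inclusion can be proper, for instance when \<open>q = 0\<close> makes weights
  vanish.\<close>

lemma feynman_coeff_support:
  "{m. feynman_coeff q w m \<noteq> 0} \<subseteq>
    (\<lambda>\<gamma>. (card (singletons_of Cre w \<gamma>), card (singletons_of Ann w \<gamma>))) ` feynman w"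
proof
  fix m assume "m \<in> {m. feynman_coeff q w m \<noteq> 0}"
  then obtain \<gamma> where "\<gamma> \<in> feynman w" "card (singletons_of Cre w \<gamma>) = fst m"
      "card (singletons_of Ann w \<gamma>) = snd m"
    unfolding feynman_coeff_def by (auto elim: sum.not_neutral_contains_not_neutral)
  then show "m \<in> (\<lambda>\<gamma>. (card (singletons_of Cre w \<gamma>), card (singletons_of Ann w \<gamma>))) ` feynman w"
    by (intro image_eqI[of _ _ \<gamma>]) (simp_all add: prod_eq_iff)
qed

lemma finite_feynman_coeff_support: "finite {m. feynman_coeff q w m \<noteq> 0}"
  using feynman_coeff_support finite_feynman by (rule finite_surj[rotated])

text \<open>The sum over diagrams is split into the fibres of the map counting single creators and
  annihilators. Indices in its image but outside the support contribute 0.\<close>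

lemma normal_form_feynman_coeff:
  "normal_form (feynman_coeff q w) = (\<Sum>\<gamma>\<in>feynman w. diagram_term q w \<gamma>)"
proof -
  let ?t = "\<lambda>\<gamma>. (card (singletons_of Cre w \<gamma>), card (singletons_of Ann w \<gamma>))"
  have "normal_form (feynman_coeff q w) =
      (\<Sum>m\<in>?t ` feynman w. Poly_Mapping.single (normal_word (fst m) (snd m)) (feynman_coeff q w m))"
    unfolding normal_form_def
    by (intro sum.mono_neutral_left feynman_coeff_support) (auto simp: finite_feynman)
  also have "\<dots> = (\<Sum>m\<in>?t ` feynman w. \<Sum>\<gamma> | \<gamma> \<in> feynman w \<and> ?t \<gamma> = m. diagram_term q w \<gamma>)"
  proof (intro sum.cong refl)
    fix m
    have "(\<Sum>\<gamma> | \<gamma> \<in> feynman w \<and> ?t \<gamma> = m. diagram_term q w \<gamma>) =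
        (\<Sum>\<gamma> | \<gamma> \<in> feynman w \<and> ?t \<gamma> = m.
          Poly_Mapping.single (normal_word (fst m) (snd m)) (q_weight q w \<gamma>))"
      by (intro sum.cong refl) (auto simp: diagram_term_def)
    also have "\<dots> = Poly_Mapping.single (normal_word (fst m) (snd m)) (feynman_coeff q w m)"
      unfolding single_sum[symmetric] feynman_coeff_def by (cases m) simp
    finally show "Poly_Mapping.single (normal_word (fst m) (snd m)) (feynman_coeff q w m) =
        (\<Sum>\<gamma> | \<gamma> \<in> feynman w \<and> ?t \<gamma> = m. diagram_term q w \<gamma>)" by simp
  qed
  also have "\<dots> = (\<Sum>\<gamma>\<in>feynman w. diagram_term q w \<gamma>)"
    by (rule sum.image_gen[symmetric]) (rule finite_feynman)
  finally show ?thesis .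
qed

lemma normal_expr_feynman_coeff: "normal_expr q (feynman_coeff q w) = word_elem q w"
  by (simp add: normal_expr_eq_q_class finite_feynman_coeff_support normal_form_feynman_coeff
      word_elem_eq_q_class q_class_word_eq_feynman_sum)

text \<open>Existence comes from the diagram expansion, uniqueness from the independence of the
  monomials.\<close>

lemma normal_coeffs_eq: "normal_coeffs q w = feynman_coeff q w"
  unfolding normal_coeffs_def
proof (rule the_equality)
  show "finite {m. feynman_coeff q w m \<noteq> 0} \<and> normal_expr q (feynman_coeff q w) = word_elem q w"
    by (simp add: finite_feynman_coeff_support normal_expr_feynman_coeff)
next
  fix C assume "finite {m. C m \<noteq> 0} \<and> normal_expr q C = word_elem q w"
  then show "C = feynman_coeff q w"
    using normal_expr_inject[of C "feynman_coeff q w" q]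
    by (simp add: finite_feynman_coeff_support normal_expr_feynman_coeff)
qed

theorem theorem3p1:
  fixes q :: complex and w :: "letter list"
  shows "normal_order q w = word_elem q w
    \<and> word_elem q w =
        (\<Oplus>\<^bsub>q_algebra q\<^esub>\<gamma> \<in> feynman w. q_weight q w \<gamma> \<odot>\<^bsub>q_algebra q\<^esub> double_dot q w \<gamma>)
    \<and> (\<forall>k l. normal_coeffs q w (k, l) =
        (\<Sum>\<gamma> | \<gamma> \<in> feynman w \<and> card (singletons_of Cre w \<gamma>) = k
                \<and> card (singletons_of Ann w \<gamma>) = l. q_weight q w \<gamma>))"
proof (intro conjI allI)
  show "normal_order q w = word_elem q w"
    by (simp add: normal_order_def normal_coeffs_eq normal_expr_feynman_coeff)
  show "word_elem q w =
      (\<Oplus>\<^bsub>q_algebra q\<^esub>\<gamma> \<in> feynman w. q_weight q w \<gamma> \<odot>\<^bsub>q_algebra q\<^esub> double_dot q w \<gamma>)"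
    \<comment> \<open>The scaled double dot monomials are the classes of the diagram terms, and
      \<open>q_class\<close> carries their sum to the sum in the algebra.\<close>
    by (simp only: word_elem_eq_q_class q_class_word_eq_feynman_sum q_class_sum[OF finite_feynman]
        double_dot_def smult_normal_monomial q_algebra_finsum diagram_term_def)
  show "normal_coeffs q w (k, l) =
      (\<Sum>\<gamma> | \<gamma> \<in> feynman w \<and> card (singletons_of Cre w \<gamma>) = k
              \<and> card (singletons_of Ann w \<gamma>) = l. q_weight q w \<gamma>)" for k l
    by (simp add: normal_coeffs_eq feynman_coeff_def)
qed

end
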